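(* Let $k\ge 2$, let $p$ be a probability mass function on $\mathbb{N}$ (not necessarily $k$-monotone), and let $p_{\mathcal{S}_k}$ be the orthogonal projection of $p$ on the set $\mathcal{P}^k$ of $k$-monotone probabilities, i.e. the minimizer of $\|f-p\|_2$ over $f\in\mathcal{P}^k$. Then, for all $r\in[2,+\infty]$, the random variable $\sqrt n\,\|p_{\mathcal{S}_k}-\hat p\|_r$ is bounded in probability (as $n\to\infty$).
   Context: $\mathbb{N}=\{0,1,2,\dots\}$. For a real sequence $f=(f(i))_{i\in\mathbb{N}}$, put $\Delta^1 f(i)=f(i+1)-f(i)$ and $\Delta^{k}f(i)=\Delta^{k-1}f(i+1)-\Delta^{k-1}f(i)$. The sequence $f$ is $k$-monotone if $(-1)^k\Delta^k f(i)\ge 0$ for all $i\in\mathbb{N}$. $\mathcal{P}^k$ is the set of probability mass functions on $\mathbb{N}$ that are $k$-monotone. $\|g\|_r=(\sum_{i\ge 0}|g(i)|^r)^{1/r}$ for $r<\infty$ and $\|g\|_\infty=\sup_i|g(i)|$. $X_1,\dots,X_n$ are i.i.d. with probability mass function $p$, $\tilde p(j)=\frac1n\sum_{i=1}^n \mathbb{I}_{\{X_i=j\}}$ is the empirical probability mass function, and $\hat p=\operatorname{argmin}\{\|f-\tilde p\|_2^2 : f\in\mathcal{P}^k\}$. These projections exist and are unique. *)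

theory Defs
  imports "HOL-Probability.Probability"
begin

primrec Delta :: "nat \<Rightarrow> (nat \<Rightarrow> real) \<Rightarrow> nat \<Rightarrow> real" where
  "Delta 0 f i = f i"
| "Delta (Suc k) f i = Delta k f (i + 1) - Delta k f i"

definition k_monotone :: "nat \<Rightarrow> (nat \<Rightarrow> real) \<Rightarrow> bool" where
  "k_monotone k f \<longleftrightarrow> (\<forall>i. (-1) ^ k * Delta k f i \<ge> 0)"

definition k_monotone_pmfs :: "nat \<Rightarrow> nat pmf set" where
  "k_monotone_pmfs k = {f. k_monotone k (pmf f)}"

(* The real-valued series and supremum take unspecified values when the sequence is not
   r-summable (respectively bounded). Below the norm is only applied to finite linear
   combinations of probability mass functions, which lie in l^1 and so in every l^r, r >= 1. *)
definition lr_norm :: "ereal \<Rightarrow> (nat \<Rightarrow> real) \<Rightarrow> real" where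
  "lr_norm r g =
     (if r = \<infinity> then (SUP i. \<bar>g i\<bar>)
      else (\<Sum>i. \<bar>g i\<bar> powr real_of_ereal r) powr (1 / real_of_ereal r))"

(* arg_min is a choice operator; for g a probability mass function the minimizer exists
   and is unique. *)
definition k_monotone_proj :: "nat \<Rightarrow> (nat \<Rightarrow> real) \<Rightarrow> nat pmf" where
  "k_monotone_proj k g =
     arg_min (\<lambda>f. lr_norm 2 (\<lambda>i. pmf f i - g i)) (\<lambda>f. f \<in> k_monotone_pmfs k)"

(* The sample of size n is X 0, ..., X (n - 1). *)
definition empirical_pmf :: "(nat \<Rightarrow> 'a \<Rightarrow> nat) \<Rightarrow> nat \<Rightarrow> 'a \<Rightarrow> nat \<Rightarrow> real" where
  "empirical_pmf X n \<omega> j = (1 / real n) * (\<Sum>i<n. of_bool (X i \<omega> = j))"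

(* Measurability is part of the notion, since measure M returns 0 on non-measurable sets. *)
definition bounded_in_probability :: "'a measure \<Rightarrow> (nat \<Rightarrow> 'a \<Rightarrow> real) \<Rightarrow> bool" where
  "bounded_in_probability M Z \<longleftrightarrow>
     (\<forall>n. Z n \<in> borel_measurable M) \<and>
     (\<forall>\<epsilon>>0. \<exists>C. \<forall>\<^sub>F n in sequentially. measure M {\<omega> \<in> space M. \<bar>Z n \<omega>\<bar> > C} < \<epsilon>)"

end

theory Submission
  imports Defs
begin

text \<open>Projection onto a convex set does not increase the \<open>l\<^sup>2\<close> distance, so the \<open>l\<^sup>2\<close> error, which
  dominates the \<open>l\<^sup>r\<close> error for \<open>r \<ge> 2\<close>, is at most the distance from the empirical mass function to
  \<open>p\<close>. The mean square of the latter is at most \<open>1 / n\<close>, and Markov's inequality concludes.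

  The set of \<open>k\<close>-monotone probabilities is not closed in \<open>l\<^sup>2\<close> (mass can escape to infinity).
  The minimizer is therefore first found among \<open>k\<close>-monotone subprobabilities, where minimizing
  sequences converge by the parallelogram identity, and then shown to have mass one.\<close>

section \<open>The square-summable inner product on absolutely summable sequences\<close>

lemma summable_mult_abs:
  fixes d e :: "nat \<Rightarrow> real"
  assumes "summable (\<lambda>i. \<bar>d i\<bar>)" "summable (\<lambda>i. \<bar>e i\<bar>)"
  shows "summable (\<lambda>i. d i * e i)"
proof (rule summable_comparison_test')
  show "summable (\<lambda>i. \<bar>d i\<bar> * (\<Sum>j. \<bar>e j\<bar>))"
    using assms(1) by (rule summable_mult2)
  have "\<bar>e i\<bar> \<le> (\<Sum>j. \<bar>e j\<bar>)" for i
    using sum_le_suminf[OF assms(2), of "{i}"] by simp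
  then show "norm (d i * e i) \<le> \<bar>d i\<bar> * (\<Sum>j. \<bar>e j\<bar>)" if "i \<ge> 0" for i
    by (simp add: abs_mult mult_left_mono)
qed

text \<open>The l^2 inner product as a plain real series. \<open>suminf\<close> is arbitrary on
  divergent series, so its laws are stated for absolutely summable sequences; differences of mass
  functions are of this kind.\<close>

definition ip :: "(nat \<Rightarrow> real) \<Rightarrow> (nat \<Rightarrow> real) \<Rightarrow> real" where
  "ip d e = (\<Sum>i. d i * e i)"

lemma summable_abs_add_scaled:
  fixes d e :: "nat \<Rightarrow> real"
  assumes "summable (\<lambda>i. \<bar>d i\<bar>)" "summable (\<lambda>i. \<bar>e i\<bar>)"
  shows "summable (\<lambda>i. \<bar>d i + t * e i\<bar>)"
proof (rule summable_comparison_test')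
  show "summable (\<lambda>i. \<bar>d i\<bar> + \<bar>t\<bar> * \<bar>e i\<bar>)"
    using assms by (intro summable_add summable_mult)
  show "norm \<bar>d i + t * e i\<bar> \<le> \<bar>d i\<bar> + \<bar>t\<bar> * \<bar>e i\<bar>" if "i \<ge> 0" for i
    using abs_triangle_ineq[of "d i" "t * e i"] by (simp add: abs_mult)
qed

lemma summable_abs_diff:
  fixes d e :: "nat \<Rightarrow> real"
  assumes "summable (\<lambda>i. \<bar>d i\<bar>)" "summable (\<lambda>i. \<bar>e i\<bar>)"
  shows "summable (\<lambda>i. \<bar>d i - e i\<bar>)"
  using summable_abs_add_scaled[OF assms, of "-1"] by simp

lemma ip_commute: "ip d e = ip e d"
  by (simp add: ip_def mult.commute)

lemma ip_add_scaled_left: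
  assumes "summable (\<lambda>i. \<bar>d i\<bar>)" "summable (\<lambda>i. \<bar>e i\<bar>)" "summable (\<lambda>i. \<bar>h i\<bar>)"
  shows "ip (\<lambda>i. d i + t * e i) h = ip d h + t * ip e h"
proof -
  have "ip (\<lambda>i. d i + t * e i) h = (\<Sum>i. d i * h i + t * (e i * h i))"
    by (simp add: ip_def algebra_simps)
  also have "\<dots> = ip d h + t * ip e h"
    using assms by (simp add: ip_def suminf_add[symmetric] suminf_mult summable_mult_abs)
  finally show ?thesis .
qed

lemma ip_add_scaled_self:
  assumes "summable (\<lambda>i. \<bar>d i\<bar>)" "summable (\<lambda>i. \<bar>e i\<bar>)"
  shows "ip (\<lambda>i. d i + t * e i) (\<lambda>i. d i + t * e i) = ip d d + 2 * t * ip d e + t\<^sup>2 * ip e e"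
proof -
  note s = summable_abs_add_scaled[OF assms, of t]
  have "ip (\<lambda>i. d i + t * e i) (\<lambda>i. d i + t * e i)
      = ip d (\<lambda>i. d i + t * e i) + t * ip e (\<lambda>i. d i + t * e i)"
    by (rule ip_add_scaled_left[OF assms s])
  also have "ip d (\<lambda>i. d i + t * e i) = ip d d + t * ip e d"
    by (subst ip_commute) (rule ip_add_scaled_left[OF assms assms(1)])
  also have "ip e (\<lambda>i. d i + t * e i) = ip d e + t * ip e e"
    by (subst ip_commute) (rule ip_add_scaled_left[OF assms assms(2)])
  also have "ip d d + t * ip e d + t * (ip d e + t * ip e e) = ip d d + 2 * t * ip d e + t\<^sup>2 * ip e e"
    unfolding ip_commute[of e d] by (simp add: algebra_simps power2_eq_square)
  finally show ?thesis .
qed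

lemma ip_self_nonneg: "0 \<le> ip d d" if "summable (\<lambda>i. \<bar>d i\<bar>)"
  unfolding ip_def using that by (intro suminf_nonneg summable_mult_abs) auto

lemma sum_square_le_ip:
  assumes "summable (\<lambda>i. \<bar>d i\<bar>)" "finite I"
  shows "(\<Sum>i\<in>I. (d i)\<^sup>2) \<le> ip d d"
  unfolding ip_def power2_eq_square using assms
  by (intro sum_le_suminf summable_mult_abs) auto

lemma square_le_ip:
  assumes "summable (\<lambda>i. \<bar>d i\<bar>)"
  shows "(d i)\<^sup>2 \<le> ip d d"
  using sum_square_le_ip[OF assms, of "{i}"] by simp

text \<open>Divide by \<open>2 * t\<close> and let \<open>t\<close> tend to 0 from the right. The
  quadratic is the change of a squared distance at parameter \<open>t\<close> along a ray from a
  minimizer, so \<open>a\<close> is half its one-sided derivative.\<close>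

lemma first_order_condition:
  fixes a b :: real
  assumes "0 < T" and *: "\<And>t. 0 < t \<Longrightarrow> t \<le> T \<Longrightarrow> 0 \<le> 2 * t * a + t\<^sup>2 * b"
  shows "0 \<le> a"
proof (rule tendsto_lowerbound)
  show "((\<lambda>t. a + t * b / 2) \<longlongrightarrow> a) (at_right 0)"
    by (auto intro!: tendsto_eq_intros)
  have "0 \<le> a + t * b / 2" if "0 < t" "t \<le> T" for t
  proof -
    have "0 \<le> (2 * t) * (a + t * b / 2)"
      using *[OF that] by (simp add: algebra_simps power2_eq_square)
    then show ?thesis using that by (simp add: zero_le_mult_iff)
  qed
  then show "\<forall>\<^sub>F t in at_right 0. 0 \<le> a + t * b / 2"
    using \<open>0 < T\<close> by (auto simp: eventually_at_right_field intro!: exI[of _ T])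
qed simp

section \<open>Comparison of l^r norms with the l^2 norm\<close>

lemma lr_norm_2:
  assumes "summable (\<lambda>i. \<bar>d i\<bar>)"
  shows "lr_norm 2 d = sqrt (ip d d)"
proof -
  have "real_of_ereal 2 = 2"
    by (metis numeral_eq_ereal real_of_ereal.simps(1))
  moreover have "\<bar>d i\<bar> powr 2 = d i * d i" for i
    by (metis abs_ge_zero power2_abs power2_eq_square powr_numeral)
  ultimately show ?thesis
    using ip_self_nonneg[OF assms] by (simp add: lr_norm_def ip_def powr_half_sqrt)
qed

text \<open>Every entry is bounded by the l^2 norm \<open>S\<close>, which settles the supremum. For
  finite exponent \<open>R\<close> it lets \<open>R - 2\<close> of the factors be replaced by
  \<open>S\<close>; summing the remaining squares gives \<open>S powr R\<close>.\<close>

lemma lr_norm_le_l2: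
  assumes d: "summable (\<lambda>i. \<bar>d i\<bar>)" and "2 \<le> r"
  shows "lr_norm r d \<le> sqrt (ip d d)"
proof (cases "r = \<infinity>")
  case True
  then show ?thesis
    using square_le_ip[OF d] by (auto simp: lr_norm_def real_le_rsqrt intro!: cSUP_least)
next
  case False
  define R where "R = real_of_ereal r"
  have R: "R \<ge> 2"
    using False \<open>2 \<le> r\<close> unfolding R_def by (cases r) auto
  define S where "S = sqrt (ip d d)"
  have S: "0 \<le> S" "S\<^sup>2 = ip d d" by (simp_all add: S_def ip_self_nonneg[OF d])
  have le: "\<bar>d i\<bar> powr R \<le> S powr (R - 2) * (d i * d i)" for i
  proof -
    \<comment> \<open>Since \<open>0 powr a = 0\<close> even for \<open>a = 0\<close>, splitting the
      exponent is valid for zero entries and for \<open>R = 2\<close>.\<close>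
    have "\<bar>d i\<bar> powr R = \<bar>d i\<bar> powr (R - 2) * \<bar>d i\<bar> powr 2"
      by (simp flip: powr_add del: powr_numeral)
    also have "\<bar>d i\<bar> powr 2 = d i * d i"
      by (metis abs_ge_zero power2_abs power2_eq_square powr_numeral)
    also have "\<bar>d i\<bar> powr (R - 2) \<le> S powr (R - 2)"
      using R square_le_ip[OF d, of i] by (intro powr_mono2) (auto simp: S_def real_le_rsqrt)
    finally show ?thesis by (simp add: mult_right_mono)
  qed
  have s: "summable (\<lambda>i. S powr (R - 2) * (d i * d i))"
    using d by (intro summable_mult summable_mult_abs)
  have s': "summable (\<lambda>i. \<bar>d i\<bar> powr R)"
    by (rule summable_comparison_test'[OF s]) (use le in auto)
  have "(\<Sum>i. \<bar>d i\<bar> powr R) \<le> (\<Sum>i. S powr (R - 2) * (d i * d i))"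
    by (rule suminf_le[OF le s' s])
  also have "\<dots> = S powr (R - 2) * S powr 2"
    using S d by (simp add: suminf_mult summable_mult_abs ip_def)
  also have "\<dots> = S powr R" by (simp flip: powr_add)
  finally have "(\<Sum>i. \<bar>d i\<bar> powr R) powr (1 / R) \<le> (S powr R) powr (1 / R)"
    using R by (intro powr_mono2 suminf_nonneg s') auto
  also have "\<dots> = S" using R S by (simp add: powr_powr)
  finally show ?thesis using False by (simp add: lr_norm_def R_def S_def)
qed

text \<open>For finite \<open>r\<close> the outer \<open>powr\<close> is nonnegative by itself. A
  real \<open>SUP\<close> is controlled only for bounded families, and here the l^1 norm is a
  bound.\<close>

lemma lr_norm_nonneg:
  assumes "summable (\<lambda>i. \<bar>d i\<bar>)"
  shows "0 \<le> lr_norm r d"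
proof -
  have "bdd_above (range (\<lambda>i. \<bar>d i\<bar>))"
    using sum_le_suminf[OF assms, of "{_}"] by (intro bdd_aboveI2[where M = "\<Sum>i. \<bar>d i\<bar>"]) simp
  then have "\<bar>d 0\<bar> \<le> (SUP i. \<bar>d i\<bar>)" by (intro cSUP_upper) auto
  then have "0 \<le> (SUP i. \<bar>d i\<bar>)" by (rule order.trans[OF abs_ge_zero])
  then show ?thesis by (simp add: lr_norm_def)
qed

section \<open>Finite differences, k-monotone sequences and subprobabilities\<close>

lemma Delta_linear:
  "Delta k (\<lambda>i. s * f i + t * h i) i = s * Delta k f i + t * Delta k h i"
proof (induction k arbitrary: i)
  case (Suc k)
  show ?case unfolding Delta.simps(2) Suc by (simp add: algebra_simps)
qed simp

lemma tendsto_Delta: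
  assumes "\<And>i. (\<lambda>m. F m i) \<longlonglongrightarrow> f i"
  shows "(\<lambda>m. Delta k (F m) i) \<longlonglongrightarrow> Delta k f i"
  by (induction k arbitrary: i) (auto intro!: tendsto_diff assms)

text \<open>Geometric sequences are eigenvectors of the difference operator, with eigenvalue
  \<open>x - 1\<close>.\<close>

lemma Delta_power: "Delta k (\<lambda>i. x ^ i) i = (x - 1) ^ k * x ^ i"
  by (induction k arbitrary: i) (auto simp: algebra_simps)

lemma k_monotone_add_scaled:
  assumes "k_monotone k f" "k_monotone k h" "0 \<le> s" "0 \<le> t"
  shows "k_monotone k (\<lambda>i. s * f i + t * h i)"
proof -
  have "(-1) ^ k * Delta k (\<lambda>i. s * f i + t * h i) i
      = s * ((-1) ^ k * Delta k f i) + t * ((-1) ^ k * Delta k h i)" for i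
    by (simp add: Delta_linear algebra_simps)
  then show ?thesis using assms by (simp add: k_monotone_def)
qed

lemma k_monotone_power:
  assumes "0 \<le> x" "x \<le> 1"
  shows "k_monotone k (\<lambda>i. x ^ i)"
proof -
  have "(-1) ^ k * Delta k (\<lambda>i. x ^ i) i = (1 - x) ^ k * x ^ i" for i
    by (simp add: Delta_power flip: power_mult_distrib mult.assoc)
  then show ?thesis using assms by (simp add: k_monotone_def)
qed

text \<open>Mass is bounded through partial sums so that each condition involves finitely many
  entries and survives pointwise limits, even when mass is lost.\<close>

definition sub_pmfs :: "nat \<Rightarrow> (nat \<Rightarrow> real) set" where
  "sub_pmfs k = {f. k_monotone k f \<and> (\<forall>i. 0 \<le> f i) \<and> (\<forall>N. (\<Sum>i<N. f i) \<le> 1)}"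

lemma sub_pmfs_summable:
  assumes "f \<in> sub_pmfs k"
  shows "summable f" "summable (\<lambda>i. \<bar>f i\<bar>)" "suminf f \<le> 1"
proof -
  show "summable f"
    using assms by (intro summableI_nonneg_bounded[of f 1]) (auto simp: sub_pmfs_def)
  moreover show "suminf f \<le> 1"
    using \<open>summable f\<close> assms by (intro suminf_le_const) (auto simp: sub_pmfs_def)
  moreover have "(\<lambda>i. \<bar>f i\<bar>) = f" using assms by (auto simp: sub_pmfs_def)
  ultimately show "summable (\<lambda>i. \<bar>f i\<bar>)" by simp
qed

lemma sub_pmfsI:
  assumes "k_monotone k f" "\<And>i. 0 \<le> f i" "summable f" "suminf f \<le> 1"
  shows "f \<in> sub_pmfs k"
proof -
  have "(\<Sum>i<N. f i) \<le> 1" for N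
    using sum_le_suminf[OF assms(3), of "{..<N}"] assms(2,4) by simp
  then show ?thesis using assms by (simp add: sub_pmfs_def)
qed

lemma sub_pmfs_convex:
  assumes "f \<in> sub_pmfs k" "h \<in> sub_pmfs k" "0 \<le> t" "t \<le> 1"
  shows "(\<lambda>i. (1 - t) * f i + t * h i) \<in> sub_pmfs k"
proof -
  have "(\<Sum>i<N. (1 - t) * f i + t * h i) \<le> 1" for N
  proof -
    have "(\<Sum>i<N. (1 - t) * f i + t * h i) = (1 - t) * (\<Sum>i<N. f i) + t * (\<Sum>i<N. h i)"
      by (simp add: sum.distrib sum_distrib_left)
    also have "\<dots> \<le> 1"
      using assms by (intro convex_bound_le) (auto simp: sub_pmfs_def)
    finally show ?thesis .
  qed
  then show ?thesis
    using assms by (auto simp: sub_pmfs_def k_monotone_add_scaled)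
qed

lemma sub_pmfs_closed:
  assumes "\<And>m. F m \<in> sub_pmfs k" and lim: "\<And>i. (\<lambda>m. F m i) \<longlonglongrightarrow> f i"
  shows "f \<in> sub_pmfs k"
proof -
  have "0 \<le> (-1) ^ k * Delta k f i" for i
    by (rule LIMSEQ_le_const[OF tendsto_mult_left[OF tendsto_Delta[OF lim]]])
      (use assms(1) in \<open>auto simp: sub_pmfs_def k_monotone_def\<close>)
  moreover have "0 \<le> f i" for i
    by (rule LIMSEQ_le_const[OF lim]) (use assms(1) in \<open>auto simp: sub_pmfs_def\<close>)
  moreover have "(\<Sum>i<N. f i) \<le> 1" for N
    by (rule LIMSEQ_le_const2[OF tendsto_sum[OF lim]])
      (use assms(1) in \<open>auto simp: sub_pmfs_def\<close>)
  ultimately show ?thesis by (simp add: sub_pmfs_def k_monotone_def)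
qed

section \<open>Existence and mass of the closest subprobability\<close>

lemma zero_in_sub_pmfs: "(\<lambda>_. 0) \<in> sub_pmfs k"
proof -
  have "Delta k (\<lambda>_. 0) i = 0" for i by (induction k arbitrary: i) auto
  then show ?thesis by (simp add: sub_pmfs_def k_monotone_def)
qed

text \<open>Only pointwise convergence of a minimizing sequence is extracted. It suffices, because
  membership and upper bounds on partial sums of the squared distance both pass to pointwise
  limits.\<close>

lemma sub_pmfs_minimizer:
  assumes g: "summable (\<lambda>i. \<bar>g i\<bar>)"
  obtains f where "f \<in> sub_pmfs k"
    "\<And>h. h \<in> sub_pmfs k \<Longrightarrow> ip (\<lambda>i. f i - g i) (\<lambda>i. f i - g i) \<le> ip (\<lambda>i. h i - g i) (\<lambda>i. h i - g i)"
proof -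
  define D where "D h = ip (\<lambda>i. h i - g i) (\<lambda>i. h i - g i)" for h
  define c where "c = (INF h\<in>sub_pmfs k. D h)"
  note sm = sub_pmfs_summable(2)
  have sd: "summable (\<lambda>i. \<bar>h i - g i\<bar>)" if "h \<in> sub_pmfs k" for h
    using summable_abs_diff[OF sm[OF that] g] .
  have bdd: "bdd_below (D ` sub_pmfs k)"
    using ip_self_nonneg[OF sd] by (intro bdd_belowI[of _ 0]) (auto simp: D_def)
  have c_le: "c \<le> D h" if "h \<in> sub_pmfs k" for h
    unfolding c_def using bdd that by (rule cINF_lower)
  have "\<exists>h\<in>sub_pmfs k. D h < c + 1 / Suc m" for m
    using cINF_less_iff[OF _ bdd, of "c + 1 / Suc m"] zero_in_sub_pmfs[of k]
    by (auto simp: c_def)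
  then obtain F where F: "\<And>m. F m \<in> sub_pmfs k" and DF: "\<And>m. D (F m) < c + 1 / Suc m"
    by metis
  have par: "(F m i - F l i)\<^sup>2 \<le> 2 / Suc m + 2 / Suc l" for m l i
  proof -
    \<comment> \<open>The midpoint \<open>u\<close> is feasible, so \<open>c \<le> D u\<close>.
      Adding the two expansions around \<open>u\<close> gives
      \<open>D (F m) + D (F l) = 2 * D u + ip e e / 2\<close>, which bounds
      \<open>ip e e\<close>.\<close>
    define u where "u = (\<lambda>i. (1 - 1/2) * F l i + 1/2 * F m i)"
    define e where "e = (\<lambda>i. F m i - F l i)"
    have u: "u \<in> sub_pmfs k" unfolding u_def by (intro sub_pmfs_convex F) auto
    have e: "summable (\<lambda>i. \<bar>e i\<bar>)" unfolding e_def by (intro summable_abs_diff sm[OF F])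
    have Fm: "u i - g i + 1/2 * (F m i - F l i) = F m i - g i"
      and Fl: "u i - g i + -1/2 * (F m i - F l i) = F l i - g i" for i
      by (simp_all add: u_def field_simps)
    have "D (F m) = D u + ip (\<lambda>i. u i - g i) e + ip e e / 4"
      using ip_add_scaled_self[OF sd[OF u] e, of "1/2"]
      unfolding D_def e_def Fm by (simp add: power2_eq_square)
    moreover have "D (F l) = D u - ip (\<lambda>i. u i - g i) e + ip e e / 4"
      using ip_add_scaled_self[OF sd[OF u] e, of "-1/2"]
      unfolding D_def e_def Fl by (simp add: power2_eq_square)
    moreover have "(F m i - F l i)\<^sup>2 \<le> ip e e"
      using square_le_ip[OF e, of i] by (simp add: e_def)
    ultimately show ?thesis using c_le[OF u] DF[of m] DF[of l] by simp
  qed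
  have "Cauchy (\<lambda>m. F m i)" for i
  proof (rule metric_CauchyI)
    fix \<epsilon> :: real assume "0 < \<epsilon>"
    \<comment> \<open>For \<open>m\<close> and \<open>l\<close> at least \<open>N\<close> the bound
      \<open>par\<close> is at most \<open>4 / N\<close>, which must lie below the square of
      \<epsilon>.\<close>
    then obtain N :: nat where N: "4 / \<epsilon>\<^sup>2 < real N" using reals_Archimedean2 by blast
    have "dist (F m i) (F l i) < \<epsilon>" if "m \<ge> N" "l \<ge> N" for m l
    proof -
      have "real N > 0" using N \<open>0 < \<epsilon>\<close> by (smt (verit) divide_nonneg_pos zero_less_power)
      then have "2 / Suc m \<le> 2 / real N" "2 / Suc l \<le> 2 / real N"
        using that by (auto intro!: divide_left_mono)
      then have "(F m i - F l i)\<^sup>2 \<le> 4 / real N" using par[of m i l] by simp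
      also have "\<dots> < \<epsilon>\<^sup>2" using N \<open>0 < \<epsilon>\<close> \<open>real N > 0\<close> by (simp add: field_simps)
      finally have "\<bar>F m i - F l i\<bar> < \<epsilon>"
        using \<open>0 < \<epsilon>\<close> by (metis abs_le_square_iff abs_of_pos linorder_not_less)
      then show ?thesis by (simp add: dist_real_def)
    qed
    then show "\<exists>M. \<forall>m\<ge>M. \<forall>n\<ge>M. dist (F m i) (F n i) < \<epsilon>" by blast
  qed
  then have "\<forall>i. \<exists>l. (\<lambda>m. F m i) \<longlonglongrightarrow> l" by (simp add: Cauchy_convergent_iff convergent_def)
  then obtain f where lim: "\<And>i. (\<lambda>m. F m i) \<longlonglongrightarrow> f i" by metis
  have f: "f \<in> sub_pmfs k" using F lim by (rule sub_pmfs_closed)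
  have lc: "(\<lambda>m. c + 1 / Suc m) \<longlonglongrightarrow> c"
    using tendsto_add[OF tendsto_const LIMSEQ_inverse_real_of_nat, of c] by (simp add: inverse_eq_divide)
  \<comment> \<open>As in Fatou's lemma: the limit in \<open>m\<close> is taken for fixed
    \<open>N\<close>, and only afterwards does \<open>N\<close> grow.\<close>
  have "(\<Sum>i<N. (f i - g i) * (f i - g i)) \<le> c" for N
  proof (rule LIMSEQ_le[OF _ lc])
    show "(\<lambda>m. \<Sum>i<N. (F m i - g i) * (F m i - g i)) \<longlonglongrightarrow> (\<Sum>i<N. (f i - g i) * (f i - g i))"
      by (intro tendsto_intros lim)
    show "\<exists>M. \<forall>m\<ge>M. (\<Sum>i<N. (F m i - g i) * (F m i - g i)) \<le> c + 1 / Suc m"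
    proof (intro exI allI impI)
      show "(\<Sum>i<N. (F m i - g i) * (F m i - g i)) \<le> c + 1 / Suc m" for m
        using sum_square_le_ip[OF sd[OF F], of "{..<N}" m] DF[of m]
        by (simp add: D_def power2_eq_square)
    qed
  qed
  then have "D f \<le> c"
    unfolding D_def ip_def by (intro suminf_le_const summable_mult_abs sd f)
  then have "D f \<le> D h" if "h \<in> sub_pmfs k" for h using c_le[OF that] by simp
  then show ?thesis using that[OF f] unfolding D_def by blast
qed

text \<open>Geometric sequences are \<open>k\<close>-monotone for every \<open>k\<close>. If the minimizer had mass less than
  one, adding a small multiple of \<open>x ^ i\<close> with \<open>x\<close> close to \<open>1\<close> would bring it closer
  to \<open>g\<close>; so no mass escapes to infinity.\<close>

lemma sub_pmfs_minimizer_suminf: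
  assumes g0: "\<And>i. 0 \<le> g i" and g1: "g sums 1" and f: "f \<in> sub_pmfs k"
    and min: "\<And>h. h \<in> sub_pmfs k \<Longrightarrow>
      ip (\<lambda>i. f i - g i) (\<lambda>i. f i - g i) \<le> ip (\<lambda>i. h i - g i) (\<lambda>i. h i - g i)"
  shows "suminf f = 1"
proof (rule ccontr)
  assume "suminf f \<noteq> 1"
  then have lt: "suminf f < 1" using sub_pmfs_summable(3)[OF f] by simp
  have f0: "0 \<le> f i" for i using f by (simp add: sub_pmfs_def)
  note sf = sub_pmfs_summable(1)[OF f]
  have sg: "summable g" using g1 by (rule sums_summable)
  have sd: "summable (\<lambda>i. \<bar>f i - g i\<bar>)"
    using summable_abs_diff[of f g] sf sg f0 g0 by simp
  \<comment> \<open>Optimality in the direction \<open>x ^ i\<close> yields that the series of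
    \<open>g i * x ^ i\<close> is at most that of \<open>f i * x ^ i\<close>, hence at most the mass
    of \<open>f\<close>. Finite sums are recorded because \<open>x\<close> will tend to 1.\<close>
  have part: "(\<Sum>i<N. g i * x ^ i) \<le> suminf f" if x: "0 < x" "x < 1" for x :: real and N
  proof -
    have sx: "summable (\<lambda>i. x ^ i)" "(\<Sum>i. x ^ i) = 1 / (1 - x)"
      using x by (simp_all add: summable_geometric suminf_geometric)
    have sx': "summable (\<lambda>i. \<bar>x ^ i\<bar>)" using sx(1) x by simp
    \<comment> \<open>The direction \<open>x ^ i\<close> has mass \<open>1 / (1 - x)\<close>, so
      \<open>T\<close> is the step that uses up exactly the mass missing from
      \<open>f\<close>.\<close>
    define T where "T = (1 - suminf f) * (1 - x)"
    have "0 \<le> ip (\<lambda>i. f i - g i) (\<lambda>i. x ^ i)"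
    proof (rule first_order_condition)
      show "0 < T" using x lt by (simp add: T_def)
      fix t :: real assume t: "0 < t" "t \<le> T"
      have "suminf (\<lambda>i. 1 * f i + t * x ^ i) = suminf f + t * (1 / (1 - x))"
        using sf sx by (simp add: suminf_add[symmetric] suminf_mult)
      also have "t * (1 / (1 - x)) \<le> 1 - suminf f"
        using t x by (simp add: T_def field_simps)
      finally have "suminf (\<lambda>i. 1 * f i + t * x ^ i) \<le> 1" by simp
      then have "(\<lambda>i. 1 * f i + t * x ^ i) \<in> sub_pmfs k"
        using f t x sf sx
        by (intro sub_pmfsI k_monotone_add_scaled k_monotone_power summable_add summable_mult)
          (auto simp: sub_pmfs_def)
      from min[OF this] show "0 \<le> 2 * t * ip (\<lambda>i. f i - g i) (\<lambda>i. x ^ i)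
          + t\<^sup>2 * ip (\<lambda>i. x ^ i) (\<lambda>i. x ^ i)"
        using ip_add_scaled_self[OF sd sx', of t] by (simp add: algebra_simps)
    qed
    also have "\<dots> = (\<Sum>i. f i * x ^ i) - (\<Sum>i. g i * x ^ i)"
      unfolding ip_def using sf sg f0 g0 sx'
      by (subst suminf_diff) (auto simp: algebra_simps intro!: summable_mult_abs)
    finally have "(\<Sum>i. g i * x ^ i) \<le> (\<Sum>i. f i * x ^ i)" by simp
    also have "\<dots> \<le> suminf f"
      using sf f0 sx' x by (intro suminf_le summable_mult_abs)
        (auto simp: mult_left_le power_le_one)
    finally show ?thesis
      using sum_le_suminf[of "\<lambda>i. g i * x ^ i" "{..<N}"] sg g0 sx' x summable_mult_abs[of g "\<lambda>i. x ^ i"]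
      by simp
  qed
  \<comment> \<open>Letting \<open>x\<close> tend to 1 in each finite sum bounds the whole mass 1 of
    \<open>g\<close> by that of \<open>f\<close>, a contradiction.\<close>
  have "(\<Sum>i<N. g i) \<le> suminf f" for N
  proof (rule tendsto_upperbound)
    show "((\<lambda>x. \<Sum>i<N. g i * x ^ i) \<longlongrightarrow> (\<Sum>i<N. g i)) (at_left 1)"
      by (auto intro!: tendsto_eq_intros)
    show "\<forall>\<^sub>F x in at_left 1. (\<Sum>i<N. g i * x ^ i) \<le> suminf f"
      using part by (auto simp: eventually_at_left_field intro!: exI[of _ 0])
  qed simp
  then have "suminf g \<le> suminf f" by (intro suminf_le_const sg)
  then show False using lt g1 by (simp add: sums_iff)
qed

section \<open>The projection onto k-monotone probabilities and its contraction property\<close>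

lemma pmf_sums_1: "pmf p sums 1" for p :: "nat pmf"
  using sums_integral_count_space_nat[OF integrable_pmf, of p] by (simp add: integral_pmf)

lemma summable_pmf: "summable (\<lambda>i. \<bar>pmf p i\<bar>)" for p :: "nat pmf"
  using pmf_sums_1[of p] by (simp add: sums_iff)

lemma pmf_in_sub_pmfs: "p \<in> k_monotone_pmfs k \<Longrightarrow> pmf p \<in> sub_pmfs k"
  using pmf_sums_1[of p] by (intro sub_pmfsI) (auto simp: k_monotone_pmfs_def sums_iff)

lemma sub_pmfs_eq_pmf:
  assumes "f \<in> sub_pmfs k" "suminf f = 1"
  obtains q where "q \<in> k_monotone_pmfs k" "pmf q = f"
proof
  have f0: "0 \<le> f i" for i using assms by (simp add: sub_pmfs_def)
  have "f sums 1" using sub_pmfs_summable(1)[OF assms(1)] assms(2) by (simp add: sums_iff)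
  then have "(\<integral>\<^sup>+x. f x \<partial>count_space UNIV) = 1"
    unfolding nn_integral_count_space_nat using suminf_ennreal_eq[OF f0] by simp
  with f0 show e: "pmf (embed_pmf f) = f" by (intro ext pmf_embed_pmf)
  then show "embed_pmf f \<in> k_monotone_pmfs k"
    using assms by (simp add: k_monotone_pmfs_def sub_pmfs_def)
qed

text \<open>The choice operator \<open>arg_min\<close> meets its specification once some minimizer
  is exhibited. The minimizer over the larger set of subprobabilities has mass one, so it minimizes
  over probabilities as well.\<close>

lemma k_monotone_proj_minimizes:
  assumes g0: "\<And>i. 0 \<le> g i" and g1: "g sums 1"
  shows "k_monotone_proj k g \<in> k_monotone_pmfs k"
    and "q \<in> k_monotone_pmfs k \<Longrightarrow>
      ip (\<lambda>i. pmf (k_monotone_proj k g) i - g i) (\<lambda>i. pmf (k_monotone_proj k g) i - g i)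
      \<le> ip (\<lambda>i. pmf q i - g i) (\<lambda>i. pmf q i - g i)"
proof -
  have sg: "summable (\<lambda>i. \<bar>g i\<bar>)" using g0 g1 by (simp add: sums_iff)
  have n2: "lr_norm 2 (\<lambda>i. pmf q i - g i) = sqrt (ip (\<lambda>i. pmf q i - g i) (\<lambda>i. pmf q i - g i))" for q
    by (intro lr_norm_2 summable_abs_diff summable_pmf sg)
  obtain f where f: "f \<in> sub_pmfs k" and min: "\<And>h. h \<in> sub_pmfs k \<Longrightarrow>
      ip (\<lambda>i. f i - g i) (\<lambda>i. f i - g i) \<le> ip (\<lambda>i. h i - g i) (\<lambda>i. h i - g i)"
    using sub_pmfs_minimizer[OF sg] by blast
  obtain q0 where q0: "q0 \<in> k_monotone_pmfs k" "pmf q0 = f"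
    using sub_pmfs_eq_pmf f sub_pmfs_minimizer_suminf[OF g0 g1 f min] by blast
  have "k_monotone_proj k g \<in> k_monotone_pmfs k \<and> (\<forall>q\<in>k_monotone_pmfs k.
      lr_norm 2 (\<lambda>i. pmf (k_monotone_proj k g) i - g i) \<le> lr_norm 2 (\<lambda>i. pmf q i - g i))"
    unfolding k_monotone_proj_def
  proof (rule arg_minI[of _ q0])
    show "\<not> lr_norm 2 (\<lambda>i. pmf q i - g i) < lr_norm 2 (\<lambda>i. pmf q0 i - g i)"
      if "q \<in> k_monotone_pmfs k" for q
      unfolding n2 unfolding q0(2) not_less real_sqrt_le_iff by (rule min[OF pmf_in_sub_pmfs[OF that]])
  qed (use q0 in \<open>auto simp: not_less\<close>)
  then show "k_monotone_proj k g \<in> k_monotone_pmfs k" "q \<in> k_monotone_pmfs k \<Longrightarrow>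
      ip (\<lambda>i. pmf (k_monotone_proj k g) i - g i) (\<lambda>i. pmf (k_monotone_proj k g) i - g i)
      \<le> ip (\<lambda>i. pmf q i - g i) (\<lambda>i. pmf q i - g i)"
    unfolding n2 by auto
qed

text \<open>The segment from the projection to \<open>q\<close> stays among the k-monotone
  probabilities, so the squared distance to \<open>g\<close> cannot decrease initially along
  it.\<close>

lemma k_monotone_proj_variational:
  assumes g0: "\<And>i. 0 \<le> g i" and g1: "g sums 1" and q: "q \<in> k_monotone_pmfs k"
  defines "f \<equiv> pmf (k_monotone_proj k g)"
  shows "0 \<le> ip (\<lambda>i. f i - g i) (\<lambda>i. pmf q i - f i)"
proof (rule first_order_condition[of 1])
  fix t :: real assume t: "0 < t" "t \<le> 1"
  have sg: "summable (\<lambda>i. \<bar>g i\<bar>)" using g0 g1 by (simp add: sums_iff)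
  note fk = k_monotone_proj_minimizes(1)[OF g0 g1, of k]
  have "(\<lambda>i. (1 - t) * f i + t * pmf q i) \<in> sub_pmfs k"
    unfolding f_def using t by (intro sub_pmfs_convex pmf_in_sub_pmfs fk q) auto
  moreover have "(\<lambda>i. (1 - t) * f i + t * pmf q i) sums ((1 - t) * 1 + t * 1)"
    unfolding f_def by (intro sums_add sums_mult pmf_sums_1)
  ultimately obtain q' where q': "q' \<in> k_monotone_pmfs k"
      "pmf q' = (\<lambda>i. (1 - t) * f i + t * pmf q i)"
    by (auto simp: sums_iff elim: sub_pmfs_eq_pmf)
  have "ip (\<lambda>i. f i - g i) (\<lambda>i. f i - g i) \<le>
      ip (\<lambda>i. (f i - g i) + t * (pmf q i - f i)) (\<lambda>i. (f i - g i) + t * (pmf q i - f i))"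
    using k_monotone_proj_minimizes(2)[OF g0 g1 q'(1)] unfolding q'(2) f_def
    by (simp add: algebra_simps)
  also have "\<dots> = ip (\<lambda>i. f i - g i) (\<lambda>i. f i - g i)
      + 2 * t * ip (\<lambda>i. f i - g i) (\<lambda>i. pmf q i - f i)
      + t\<^sup>2 * ip (\<lambda>i. pmf q i - f i) (\<lambda>i. pmf q i - f i)"
    unfolding f_def by (intro ip_add_scaled_self summable_abs_diff summable_pmf sg)
  finally show "0 \<le> 2 * t * ip (\<lambda>i. f i - g i) (\<lambda>i. pmf q i - f i)
      + t\<^sup>2 * ip (\<lambda>i. pmf q i - f i) (\<lambda>i. pmf q i - f i)" by simp
qed simp

text \<open>Adding the variational inequalities at the two projections, each tested against the
  other, gives \<open>ip d d \<le> ip e d\<close>. Expanding the square of \<open>d - e\<close>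
  gives \<open>2 * ip e d \<le> ip d d + ip e e\<close>.\<close>

lemma k_monotone_proj_nonexpansive:
  fixes k :: nat
  assumes g: "\<And>i. 0 \<le> g i" "g sums 1" and h: "\<And>i. 0 \<le> h i" "h sums 1"
  defines "P \<equiv> \<lambda>g. pmf (k_monotone_proj k g)"
  shows "ip (\<lambda>i. P g i - P h i) (\<lambda>i. P g i - P h i) \<le> ip (\<lambda>i. g i - h i) (\<lambda>i. g i - h i)"
proof -
  have sg: "summable (\<lambda>i. \<bar>g i\<bar>)" using g by (simp add: sums_iff)
  have sh: "summable (\<lambda>i. \<bar>h i\<bar>)" using h by (simp add: sums_iff)
  have sP: "summable (\<lambda>i. \<bar>P g i\<bar>)" for g unfolding P_def by (rule summable_pmf)
  define d where "d = (\<lambda>i. P g i - P h i)"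
  define e where "e = (\<lambda>i. g i - h i)"
  have sd: "summable (\<lambda>i. \<bar>d i\<bar>)" unfolding d_def by (intro summable_abs_diff sP)
  have se: "summable (\<lambda>i. \<bar>e i\<bar>)" unfolding e_def by (intro summable_abs_diff sg sh)
  have "0 \<le> ip (\<lambda>i. P g i - g i) (\<lambda>i. P h i - P g i)"
    unfolding P_def by (intro k_monotone_proj_variational k_monotone_proj_minimizes(1) g h)
  moreover have "ip (\<lambda>i. P g i - g i) (\<lambda>i. P h i - P g i) = - ip (\<lambda>i. P g i - g i) d"
    using ip_add_scaled_left[of "\<lambda>_. 0" d "\<lambda>i. P g i - g i" "-1"] sd summable_abs_diff[OF sP sg, of g]
    by (simp add: ip_commute[of "\<lambda>i. P g i - g i"] d_def) (simp add: ip_def)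
  moreover have "0 \<le> ip (\<lambda>i. P h i - h i) d"
    unfolding P_def d_def by (intro k_monotone_proj_variational k_monotone_proj_minimizes(1) g h)
  moreover have "ip (\<lambda>i. P h i - h i) d = ip (\<lambda>i. P g i - g i) d - ip (\<lambda>i. d i - e i) d"
  proof -
    \<comment> \<open>This rests on \<open>P h - h = (P g - g) - (d - e)\<close>.\<close>
    have "ip (\<lambda>i. (P g i - g i) + (-1) * (d i - e i)) d
        = ip (\<lambda>i. P g i - g i) d + (-1) * ip (\<lambda>i. d i - e i) d"
      by (intro ip_add_scaled_left summable_abs_diff sP sg sd se)
    then show ?thesis by (simp add: d_def e_def)
  qed
  moreover have "ip (\<lambda>i. d i - e i) d = ip d d - ip e d"
    using ip_add_scaled_left[OF sd se sd, of "-1"] by simp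
  moreover have "0 \<le> ip d d - 2 * ip e d + ip e e"
    using ip_self_nonneg[OF summable_abs_add_scaled[OF sd se, of "-1"]]
      ip_add_scaled_self[OF sd se, of "-1"] by (simp add: ip_commute)
  ultimately show ?thesis unfolding d_def[symmetric] e_def[symmetric] by simp
qed

section \<open>The empirical mass function: measurability and mean square error\<close>

lemma empirical_pmf_nonneg: "0 \<le> empirical_pmf X n \<omega> j"
  by (simp add: empirical_pmf_def sum_nonneg)

lemma empirical_pmf_sums_1:
  assumes "0 < n"
  shows "empirical_pmf X n \<omega> sums 1"
proof -
  have "(\<lambda>j. of_bool (X i \<omega> = j) :: real) sums 1" for i
    using sums_single[of "X i \<omega>" "\<lambda>_. 1::real"] by (simp add: of_bool_def eq_commute)
  then have "(\<lambda>j. (1 / real n) * (\<Sum>i<n. of_bool (X i \<omega> = j))) sums ((1 / real n) * (\<Sum>i<n. 1))"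
    by (intro sums_mult sums_sum)
  then show ?thesis using assms by (simp add: empirical_pmf_def[abs_def])
qed

text \<open>The sample \<open>(X 0, \<dots>, X (n - 1))\<close> takes countably many values, so no regularity
  of \<open>F\<close> is needed.\<close>

lemma measurable_empirical_pmf:
  assumes [measurable]: "\<And>i. X i \<in> measurable M (count_space UNIV)"
  shows "(\<lambda>\<omega>. F (empirical_pmf X n \<omega>)) \<in> borel_measurable M"
proof -
  define S where "S \<omega> = map (\<lambda>i. X i \<omega>) [0..<n]" for \<omega>
  have "S -` {l} \<inter> space M \<in> sets M" for l
  proof (cases "length l = n")
    case True
    then have "S \<omega> = l \<longleftrightarrow> (\<forall>i\<in>{..<n}. X i \<omega> = l ! i)" for \<omega>
      unfolding S_def list_eq_iff_nth_eq by (simp add: Ball_def)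
    then have "S -` {l} \<inter> space M = {\<omega> \<in> space M. \<forall>i\<in>{..<n}. X i \<omega> = l ! i}"
      by blast
    then show ?thesis by simp
  next
    case False
    then have "S -` {l} = {}" by (auto simp: S_def)
    then show ?thesis by simp
  qed
  \<comment> \<open>Lists over \<open>nat\<close> form a countable type, so measurable fibres
    suffice; any function on \<open>count_space UNIV\<close> is then measurable, whatever
    \<open>F\<close> is.\<close>
  then have "S \<in> measurable M (count_space UNIV)"
    by (subst measurable_count_space_eq2_countable) auto
  then have "(\<lambda>\<omega>. F (\<lambda>j. (1 / real n) * (\<Sum>i<n. of_bool (S \<omega> ! i = j)))) \<in> borel_measurable M"
    by measurable
  moreover have "empirical_pmf X n \<omega> = (\<lambda>j. (1 / real n) * (\<Sum>i<n. of_bool (S \<omega> ! i = j)))" for \<omega>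
    by (simp add: empirical_pmf_def S_def fun_eq_iff)
  ultimately show ?thesis by simp
qed

text \<open>The variance of a mean of independent indicators: cross terms vanish and each diagonal
  term is \<open>q - q * q\<close>. The bound by \<open>q\<close> is summable over \<open>j\<close>,
  as a uniform constant would not be.\<close>

lemma (in prob_space) empirical_pmf_mean_square_error:
  assumes indep: "indep_vars (\<lambda>_. count_space UNIV) X UNIV"
    and distr: "\<And>i. distr M (count_space UNIV) (X i) = measure_pmf p"
    and n: "0 < n"
  shows "integrable M (\<lambda>\<omega>. (pmf p j - empirical_pmf X n \<omega> j)\<^sup>2)"
    and "expectation (\<lambda>\<omega>. (pmf p j - empirical_pmf X n \<omega> j)\<^sup>2) \<le> pmf p j / n"
proof -
  have rv[measurable]: "X i \<in> measurable M (count_space UNIV)" for i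
    using indep by (simp add: indep_vars_def)
  define q where "q = pmf p j"
  have q: "0 \<le> q" "q \<le> 1" by (simp_all add: q_def pmf_le_1)
  define Y where "Y i \<omega> = of_bool (X i \<omega> = j) - q" for i \<omega>
  have Ym[measurable]: "Y i \<in> borel_measurable M" for i unfolding Y_def by measurable
  have Yb: "\<bar>Y i \<omega>\<bar> \<le> 1" for i \<omega> using q by (auto simp: Y_def)
  have Yi: "integrable M (Y i)" for i
    by (rule integrable_const_bound[of _ 1]) (use Yb in auto)
  have YYi: "integrable M (\<lambda>\<omega>. Y i \<omega> * Y l \<omega>)" for i l
    by (rule integrable_const_bound[of _ 1]) (use Yb in \<open>auto simp: abs_mult mult_le_one\<close>)
  have EX: "expectation (\<lambda>\<omega>. of_bool (X i \<omega> = j)) = q" for i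
  proof -
    have "measure_pmf.expectation p (\<lambda>x. of_bool (x = j) :: real) = expectation (\<lambda>\<omega>. of_bool (X i \<omega> = j))"
      unfolding distr[of i, symmetric] by (rule integral_distr[OF rv]) simp
    moreover have "(\<lambda>x. of_bool (x = j) :: real) = indicator {j}"
      by (auto simp: fun_eq_iff)
    ultimately show ?thesis by (simp add: q_def pmf.rep_eq)
  qed
  have bi: "integrable M (\<lambda>\<omega>. of_bool (X i \<omega> = j) :: real)" for i
    by (rule integrable_const_bound[of _ 1]) auto
  have EY: "expectation (Y i) = 0" for i
    unfolding Y_def using bi[of i] by (simp add: EX prob_space)
  have EYY: "expectation (\<lambda>\<omega>. Y i \<omega> * Y i \<omega>) \<le> q" for i
  proof -
    have "Y i \<omega> * Y i \<omega> = (1 - 2 * q) * of_bool (X i \<omega> = j) + q * q" for \<omega>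
      by (simp add: Y_def algebra_simps)
    then have "expectation (\<lambda>\<omega>. Y i \<omega> * Y i \<omega>) = (1 - 2 * q) * q + q * q"
      using bi[of i] by (simp add: EX prob_space)
    also have "\<dots> \<le> q" using q by (simp add: algebra_simps)
    finally show ?thesis .
  qed
  have "indep_vars (\<lambda>_. borel) Y UNIV"
    unfolding Y_def[abs_def] by (rule indep_vars_compose2[OF indep]) auto
  then have indep_pair: "indep_vars (\<lambda>_. borel) Y {i, l}" for i l
    by (rule indep_vars_subset) auto
  have E0: "expectation (\<lambda>\<omega>. Y i \<omega> * Y l \<omega>) = 0" if "i \<noteq> l" for i l
    using indep_vars_lebesgue_integral[OF _ indep_pair[of i l]] Yi that by (simp add: EY)
  have eq: "(pmf p j - empirical_pmf X n \<omega> j)\<^sup>2 = (\<Sum>i<n. \<Sum>l<n. Y i \<omega> * Y l \<omega>) / (real n)\<^sup>2" for \<omega>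
  proof -
    have "(\<Sum>i<n. Y i \<omega>) = real n * (empirical_pmf X n \<omega> j - pmf p j)"
      using n by (simp add: Y_def empirical_pmf_def sum_subtractf q_def algebra_simps)
    then have "(\<Sum>i<n. \<Sum>l<n. Y i \<omega> * Y l \<omega>) = (real n)\<^sup>2 * (pmf p j - empirical_pmf X n \<omega> j)\<^sup>2"
      by (simp add: sum_product[symmetric] power2_eq_square) (simp add: algebra_simps)
    then show ?thesis using n by simp
  qed
  show "integrable M (\<lambda>\<omega>. (pmf p j - empirical_pmf X n \<omega> j)\<^sup>2)"
    unfolding eq by (intro integrable_divide Bochner_Integration.integrable_sum YYi)
  have "expectation (\<lambda>\<omega>. \<Sum>i<n. \<Sum>l<n. Y i \<omega> * Y l \<omega>)
      = (\<Sum>i<n. \<Sum>l<n. expectation (\<lambda>\<omega>. Y i \<omega> * Y l \<omega>))"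
    by (simp add: YYi)
  also have "\<dots> = (\<Sum>i<n. \<Sum>l<n. if l = i then expectation (\<lambda>\<omega>. Y i \<omega> * Y i \<omega>) else 0)"
    by (intro sum.cong) (auto simp: E0)
  also have "\<dots> = (\<Sum>i<n. expectation (\<lambda>\<omega>. Y i \<omega> * Y i \<omega>))" by simp
  also have "\<dots> \<le> real n * q" using sum_bounded_above[of "{..<n}", OF EYY] by simp
  finally show "expectation (\<lambda>\<omega>. (pmf p j - empirical_pmf X n \<omega> j)\<^sup>2) \<le> pmf p j / n"
    unfolding eq using n by (simp add: q_def field_simps power2_eq_square)
qed

text \<open>With values in the extended nonnegative reals, sum and integral may be exchanged given
  measurability alone. The coordinatewise bounds then add up to \<open>1 / n\<close>.\<close>

lemma (in prob_space) nn_integral_empirical_pmf_error: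
  assumes indep: "indep_vars (\<lambda>_. count_space UNIV) X UNIV"
    and distr: "\<And>i. distr M (count_space UNIV) (X i) = measure_pmf p"
    and n: "0 < n"
  defines "d \<equiv> \<lambda>\<omega> j. pmf p j - empirical_pmf X n \<omega> j"
  shows "(\<integral>\<^sup>+\<omega>. ennreal (ip (d \<omega>) (d \<omega>)) \<partial>M) \<le> ennreal (1 / n)"
proof -
  have [measurable]: "X i \<in> measurable M (count_space UNIV)" for i
    using indep by (simp add: indep_vars_def)
  have "summable (\<lambda>j. \<bar>empirical_pmf X n \<omega> j\<bar>)" for \<omega>
    using empirical_pmf_sums_1[OF n, of X \<omega>] by (simp add: sums_iff empirical_pmf_nonneg)
  then have sd: "summable (\<lambda>j. \<bar>d \<omega> j\<bar>)" for \<omega>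
    unfolding d_def by (intro summable_abs_diff summable_pmf)
  have [measurable]: "(\<lambda>\<omega>. d \<omega> j) \<in> borel_measurable M" for j
    unfolding d_def by (rule measurable_empirical_pmf[of X M "\<lambda>f. pmf p j - f j"]) measurable
  have "(\<integral>\<^sup>+\<omega>. ennreal (ip (d \<omega>) (d \<omega>)) \<partial>M) = (\<integral>\<^sup>+\<omega>. (\<Sum>j. ennreal ((d \<omega> j)\<^sup>2)) \<partial>M)"
    unfolding ip_def power2_eq_square using sd
    by (intro nn_integral_cong suminf_ennreal2[symmetric] summable_mult_abs) auto
  also have "\<dots> = (\<Sum>j. \<integral>\<^sup>+\<omega>. ennreal ((d \<omega> j)\<^sup>2) \<partial>M)"
    by (intro nn_integral_suminf) measurable
  also have "\<dots> \<le> (\<Sum>j. ennreal (pmf p j / n))"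
  proof (rule suminf_le)
    show "(\<integral>\<^sup>+\<omega>. ennreal ((d \<omega> j)\<^sup>2) \<partial>M) \<le> ennreal (pmf p j / n)" for j
      unfolding d_def using empirical_pmf_mean_square_error[OF indep distr n, of j]
      by (subst nn_integral_eq_integral) (auto intro: ennreal_leI)
  qed auto
  also have "\<dots> = ennreal (1 / n)"
    using sums_divide[OF pmf_sums_1[of p]] by (intro suminf_ennreal_eq) auto
  finally show ?thesis .
qed

section \<open>Boundedness in probability\<close>

theorem theorem5:
  fixes k :: nat and p :: "nat pmf" and M :: "'a measure"
    and X :: "nat \<Rightarrow> 'a \<Rightarrow> nat" and r :: ereal
  assumes "k \<ge> 2"
    and "prob_space M"
    and "prob_space.indep_vars M (\<lambda>_. count_space UNIV) X UNIV"
    and "\<And>i. distr M (count_space UNIV) (X i) = measure_pmf p"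
    and "2 \<le> r"
  shows "bounded_in_probability M
    (\<lambda>n \<omega>. sqrt (real n) *
       lr_norm r (\<lambda>i. pmf (k_monotone_proj k (pmf p)) i
                    - pmf (k_monotone_proj k (empirical_pmf X n \<omega>)) i))"
    (is "bounded_in_probability M ?Z")
  unfolding bounded_in_probability_def
proof (intro conjI allI impI)
  interpret prob_space M by fact
  have rv[measurable]: "X i \<in> measurable M (count_space UNIV)" for i
    using assms(3) by (simp add: indep_vars_def)
  show "?Z n \<in> borel_measurable M" for n
    by (rule measurable_empirical_pmf[OF rv])
  fix \<epsilon> :: real assume \<epsilon>: "0 < \<epsilon>"
  \<comment> \<open>Markov's inequality will bound the probability by
    \<open>(n / C^2) * (1 / n) = 1 / C^2\<close>; this choice makes it half of \<epsilon>, for every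
    positive \<open>n\<close>.\<close>
  define C where "C = sqrt (2 / \<epsilon>)"
  have C: "0 < C" "C\<^sup>2 = 2 / \<epsilon>" using \<epsilon> by (simp_all add: C_def)
  have "measure M {\<omega> \<in> space M. \<bar>?Z n \<omega>\<bar> > C} < \<epsilon>" if n: "n > 0" for n
  proof -
    define D where "D \<omega> = ip (\<lambda>j. pmf p j - empirical_pmf X n \<omega> j)
      (\<lambda>j. pmf p j - empirical_pmf X n \<omega> j)" for \<omega>
    have [measurable]: "D \<in> borel_measurable M"
      unfolding D_def by (rule measurable_empirical_pmf[OF rv,
        of "\<lambda>f. ip (\<lambda>j. pmf p j - f j) (\<lambda>j. pmf p j - f j)"])
    \<comment> \<open>The event is put into the form that Markov's inequality takes. Contraction
      bounds the l^2 distance of the two projections by the square root of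
      \<open>D \<omega>\<close>, and the l^r norm lies below it.\<close>
    have ZD: "1 \<le> ennreal (real n / C\<^sup>2) * ennreal (D \<omega>)" if Z: "\<bar>?Z n \<omega>\<bar> > C" for \<omega>
    proof -
      let ?P = "\<lambda>i. pmf (k_monotone_proj k (pmf p)) i
                    - pmf (k_monotone_proj k (empirical_pmf X n \<omega>)) i"
      have sP: "summable (\<lambda>i. \<bar>?P i\<bar>)" by (intro summable_abs_diff summable_pmf)
      have le: "ip ?P ?P \<le> D \<omega>" unfolding D_def
        by (intro k_monotone_proj_nonexpansive pmf_nonneg pmf_sums_1
            empirical_pmf_nonneg empirical_pmf_sums_1 n)
      have "C < sqrt n * lr_norm r ?P" using Z lr_norm_nonneg[OF sP, of r] by simp
      also have "\<dots> \<le> sqrt n * sqrt (D \<omega>)"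
        using order.trans[OF lr_norm_le_l2[OF sP assms(5)] real_sqrt_le_mono[OF le]]
        by (rule mult_left_mono) simp
      finally have "C\<^sup>2 < (sqrt n * sqrt (D \<omega>))\<^sup>2" using C by (intro power_strict_mono) auto
      also have "\<dots> = n * D \<omega>"
        using ip_self_nonneg[OF sP] le by (simp add: power_mult_distrib)
      finally have "1 \<le> real n / C\<^sup>2 * D \<omega>"
        using C(1) by (simp add: pos_le_divide_eq less_imp_le)
      then show ?thesis by (simp add: ennreal_mult'[symmetric])
    qed
    have "emeasure M {\<omega> \<in> space M. \<bar>?Z n \<omega>\<bar> > C}
        \<le> emeasure M {\<omega> \<in> space M. 1 \<le> ennreal (real n / C\<^sup>2) * ennreal (D \<omega>)}"
      using ZD by (intro emeasure_mono) auto
    also have "\<dots> \<le> ennreal (real n / C\<^sup>2) * (\<integral>\<^sup>+\<omega>. ennreal (D \<omega>) * indicator (space M) \<omega> \<partial>M)"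
      by (intro nn_integral_Markov_inequality) auto
    also have "(\<integral>\<^sup>+\<omega>. ennreal (D \<omega>) * indicator (space M) \<omega> \<partial>M) = (\<integral>\<^sup>+\<omega>. ennreal (D \<omega>) \<partial>M)"
      by (intro nn_integral_cong) auto
    also have "\<dots> \<le> ennreal (1 / n)"
      unfolding D_def by (rule nn_integral_empirical_pmf_error[OF assms(3,4) n])
    also have "ennreal (real n / C\<^sup>2) * ennreal (1 / n) = ennreal (real n / C\<^sup>2 * (1 / n))"
      by (rule ennreal_mult[symmetric]) auto
    also have "real n / C\<^sup>2 * (1 / n) = \<epsilon> / 2"
      unfolding C(2) using n by simp
    finally have "measure M {\<omega> \<in> space M. \<bar>?Z n \<omega>\<bar> > C} \<le> \<epsilon> / 2"
      using \<epsilon> by (simp add: emeasure_eq_measure mult_left_mono)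
    then show ?thesis using \<epsilon> by simp
  qed
  then have "\<forall>\<^sub>F n in sequentially. measure M {\<omega> \<in> space M. \<bar>?Z n \<omega>\<bar> > C} < \<epsilon>"
    by (auto simp: eventually_sequentially intro!: exI[of _ 1])
  then show "\<exists>C. \<forall>\<^sub>F n in sequentially. measure M {\<omega> \<in> space M. \<bar>?Z n \<omega>\<bar> > C} < \<epsilon>" by blast
qed

end
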